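(* Let $A\in\mathbb{R}^{m\times n}$, $m\ge n$, have full rank, let $0<u<u_\ell$, and let $\widetilde V\in\mathbb{R}^{n\times n}$ be a preconditioner constructed by orthogonalizing, at precision $u$, a right singular vector matrix of $A$ computed at precision $u_\ell$ (or by the low-precision bidiagonalization variant described in the context), so that $\|\widetilde V^T\widetilde V-I\|_2\le p_1u<1$ and $$A+\Delta A=\widetilde U_\ell\,\Sigma_\ell\,(\widetilde V+\Delta\widetilde V)^T,\qquad \|\Delta A\|_2\le p_6u_\ell\|A\|_2,\quad \|\Delta\widetilde V\|_2\le p_6u,$$ where $\widetilde U_\ell\in\mathbb{R}^{m\times n}$ has exactly orthonormal columns, $\Sigma_\ell\in\mathbb{R}^{n\times n}$ is diagonal with nonnegative diagonal entries, $\widetilde V+\Delta\widetilde V$ is exactly orthogonal, and $p_6\ge p_1$. Let $\widetilde A=A\widetilde V$. Suppose that $u_\ell$ is sufficiently small such that $$5p_6(u_\ell+u)\kappa_2(A)\le 1.$$ Then $\kappa_2^D(\widetilde A)\le 3$.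
   Context: $\kappa_2(X)=\sigma_{\max}(X)/\sigma_{\min}(X)$ for $X$ of full column rank. $\kappa_2^D(X)=\kappa_2(XD)$ with $D=\mathrm{diag}(\|x_i\|_2^{-1})$, $x_i$ the $i$th column of $X$. $p_1=p_1(m,n)$ and $p_6=p_6(m,n)$ denote low-degree polynomials in $m$ and $n$. $u$ and $u_\ell$ are the unit roundoffs of the working and low precision. Two constructions of $\widetilde V$ are considered. (i) Compute an SVD $A=U_\ell\Sigma_\ell V_\ell^T$ at precision $u_\ell$, then orthogonalize $V_\ell$ to $\widetilde V$ at precision $u$. (ii) Bidiagonalize $A$ to $B_\ell$ by the Householder method at precision $u_\ell$, storing the Householder vectors of the right transformations; promote these vectors to precision $u$; compute an SVD $U_\ell\Sigma_\ell V_\ell^T$ of $B_\ell$ at precision $u$; form $\widetilde V$ by applying the Householder matrices constructed from the stored vectors to $V_\ell$ at precision $u$. Preconditioners from both constructions satisfy the properties of $\widetilde V$ listed in the claim; these properties (with $\widetilde U_\ell$ a perturbation of $U_\ell$) are what defines $p_6$. *)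

theory Defs
  imports "HOL-Analysis.Analysis"
begin

(* The library norm on real^'n^'m is the Frobenius norm, hence the operator norm here;
   the vector norm on real^'n is the Euclidean one. *)
definition spectral_norm :: "real^'n^'m \<Rightarrow> real" where
  "spectral_norm X = onorm ((*v) X)"

(* Square roots of the eigenvalues of X^T X. For at least as many rows as columns these are all
   the singular values of X; for fewer rows, structural zeros would be included as well. *)
definition singular_values :: "real^'n^'m \<Rightarrow> real set" where
  "singular_values X =
     {sqrt l | l. \<exists>v. v \<noteq> 0 \<and> (transpose X ** X) *v v = l *s v}"

definition sigma_max :: "real^'n^'m \<Rightarrow> real" where
  "sigma_max X = Max (singular_values X)"

definition sigma_min :: "real^'n^'m \<Rightarrow> real" where
  "sigma_min X = Min (singular_values X)"

(* Meaningful for X of full column rank only; otherwise the quotient is x / 0 = 0. *)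
definition kappa2 :: "real^'n^'m \<Rightarrow> real" where
  "kappa2 X = sigma_max X / sigma_min X"

definition column_scaling :: "real^'n^'m \<Rightarrow> real^'n^'n" where
  "column_scaling X = (\<chi> i j. if i = j then inverse (norm (column i X)) else 0)"

definition kappa2D :: "real^'n^'m \<Rightarrow> real" where
  "kappa2D X = kappa2 (X ** column_scaling X)"

end

theory Submission
  imports Defs
begin

text \<open>
  Up to a small error the preconditioned matrix already has orthogonal columns.
  Write \<open>W = V + \<Delta>V\<close>, which is orthogonal. Then \<open>A V = U \<Sigma> + E\<close> with
  \<open>E = - (\<Delta>A W + A \<Delta>V)\<close>, so that \<open>\<parallel>E\<parallel> \<le> p\<^sub>6 (u\<^sub>l + u) \<parallel>A\<parallel>\<close>; because \<open>\<parallel>A\<parallel>\<close> is at most the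
  largest singular value of \<open>A\<close>, the smallness hypothesis makes this bound at most
  \<open>\<sigma> / 5\<close>, where \<open>\<sigma>\<close> is the smallest singular value of \<open>A\<close>.

  The columns of \<open>A V\<close> cannot be short: \<open>A W\<close> stretches every vector by at least \<open>\<sigma>\<close>, and
  \<open>A \<Delta>V\<close> takes away at most \<open>\<sigma> / 5\<close>, which leaves columns of norm at least \<open>4 \<sigma> / 5\<close>.
  Thus \<open>E\<close> is at most \<open>\<delta> = 1/4\<close> relative to every column of \<open>A V\<close>. The matrix \<open>U \<Sigma>\<close> has
  orthogonal columns of norms \<open>\<Sigma> $ i $ i\<close>, and these differ from the column norms
  of \<open>A V\<close> by a factor in \<open>[1 - \<delta>, 1 + \<delta>]\<close>. After scaling the columns of \<open>A V\<close> to unit length,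
  the main part therefore stretches vectors by a factor in \<open>[1 - \<delta>, 1 + \<delta>]\<close> and the error part
  contributes at most \<open>\<delta>\<close> more. The condition number is at most
  \<open>(1 + 2 \<delta>) / (1 - 2 \<delta>) = 3\<close>. This is the lemma \<open>kappa2D_perturbed_orthogonal_columns\<close>.

  Singular values enter the theorem as square roots of eigenvalues of \<open>X\<^sup>T X\<close>. The lemmas
  \<open>sigma_min_bound\<close> and \<open>sigma_max_bound\<close> turn them into the extreme stretching factors of \<open>X\<close>,
  by the variational argument: an extremal vector of the Rayleigh quotient is an eigenvector.
\<close>

section \<open>Extremal singular values as stretching factors\<close>

text \<open>
  If \<open>w = f v\<close> were nonzero, moving from \<open>v\<close> a little in the direction \<open>- w\<close> would make the
  quadratic form negative: its first-order change is \<open>- 2 t (w \<bullet> w)\<close>.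
\<close>
lemma semidefinite_null_vector:
  fixes f :: "'a::real_inner \<Rightarrow> 'a"
  assumes "linear f" and sym: "\<And>x y. f x \<bullet> y = x \<bullet> f y"
    and nonneg: "\<And>x. 0 \<le> x \<bullet> f x" and null: "v \<bullet> f v = 0"
  shows "f v = 0"
proof (rule ccontr)
  define w where "w = f v"
  define c where "c = w \<bullet> f w"
  (* The minimiser of the resulting parabola is (w \<bullet> w) / c; adding 1 avoids dividing by zero. *)
  define t where "t = (w \<bullet> w) / (c + 1)"
  assume "f v \<noteq> 0"
  then have w: "0 < w \<bullet> w" by (simp add: w_def)
  have c: "0 \<le> c" using nonneg by (simp add: c_def)
  have t: "0 < t" using w c by (simp add: t_def)
  have "t * c \<le> w \<bullet> w"
    using w c by (simp add: t_def field_simps)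
  have "0 \<le> (v - t *\<^sub>R w) \<bullet> f (v - t *\<^sub>R w)" by (rule nonneg)
  also have "\<dots> = v \<bullet> f v - t * (v \<bullet> f w) - t * (w \<bullet> f v) + t * (t * (w \<bullet> f w))"
    by (simp add: linear_diff[OF \<open>linear f\<close>] linear_scale[OF \<open>linear f\<close>] inner_diff_left inner_diff_right algebra_simps)
  also have "v \<bullet> f w = w \<bullet> w" by (simp add: w_def flip: sym)
  finally have "0 \<le> t * (t * c - 2 * (w \<bullet> w))"
    by (simp add: null[folded w_def] c_def algebra_simps flip: w_def)
  with t have "0 \<le> t * c - 2 * (w \<bullet> w)" by (simp add: zero_le_mult_iff)
  with \<open>t * c \<le> w \<bullet> w\<close> w show False by linarith
qed

text \<open>
  Eigenvectors for distinct eigenvalues are orthogonal, hence independent, so the dimension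
  bounds their number.
\<close>
lemma finite_eigenvalues_self_adjoint:
  fixes f :: "'a::euclidean_space \<Rightarrow> 'a"
  assumes sym: "\<And>x y. f x \<bullet> y = x \<bullet> f y"
  shows "finite {l. \<exists>v. v \<noteq> 0 \<and> f v = l *\<^sub>R v}" (is "finite ?L")
proof -
  obtain e where e: "\<And>l. l \<in> ?L \<Longrightarrow> e l \<noteq> 0 \<and> f (e l) = l *\<^sub>R e l"
    using bchoice[of ?L "\<lambda>l v. v \<noteq> 0 \<and> f v = l *\<^sub>R v"] by auto
  have orth: "e l \<bullet> e m = 0" if "l \<in> ?L" "m \<in> ?L" "l \<noteq> m" for l m
    using sym[of "e l" "e m"] e[OF that(1)] e[OF that(2)] that(3) by simp
  have inj: "inj_on e ?L"
  proof (rule inj_onI, rule ccontr)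
    fix l m assume lm: "l \<in> ?L" "m \<in> ?L" "e l = e m" "l \<noteq> m"
    from orth[OF lm(1,2,4)] e[OF lm(1)] lm(3) show False by simp
  qed
  have "pairwise orthogonal (e ` ?L)"
    unfolding pairwise_def orthogonal_def
  proof (intro ballI impI)
    fix v w assume "v \<in> e ` ?L" "w \<in> e ` ?L" "v \<noteq> w"
    then obtain l m where "l \<in> ?L" "m \<in> ?L" "v = e l" "w = e m" "l \<noteq> m" by blast
    with orth[of l m] show "v \<bullet> w = 0" by simp
  qed
  moreover have "0 \<notin> e ` ?L"
  proof
    assume "0 \<in> e ` ?L"
    then obtain l where "0 = e l" "l \<in> ?L" by (rule imageE)
    with e[of l] show False by simp
  qed
  ultimately have "finite (e ` ?L)"
    by (rule independent_imp_finite[OF pairwise_orthogonal_independent])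
  then show ?thesis using inj by (rule finite_imageD)
qed

lemma gram_inner: "((transpose X ** X) *v x) \<bullet> y = (X *v x) \<bullet> (X *v y)"
  for X :: "real^'n^'m"
  by (metis dot_lmul_matrix inner_commute matrix_vector_mul_assoc transpose_matrix_vector)

lemma singular_values_altdef:
  "singular_values X = sqrt ` {l. \<exists>v. v \<noteq> 0 \<and> (transpose X ** X) *v v = l *\<^sub>R v}"
  unfolding singular_values_def scalar_mult_eq_scaleR by auto

lemma finite_singular_values: "finite (singular_values X)"
  unfolding singular_values_altdef
  by (intro finite_imageI finite_eigenvalues_self_adjoint)
     (metis gram_inner inner_commute)

lemma singular_valueE:
  assumes "s \<in> singular_values X"
  obtains v where "v \<noteq> 0" "norm (X *v v) = s * norm v"
proof -
  obtain l v where lv: "s = sqrt l" "v \<noteq> 0" "(transpose X ** X) *v v = l *\<^sub>R v"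
    using assms unfolding singular_values_altdef by auto
  have "(norm (X *v v))\<^sup>2 = l * (norm v)\<^sup>2"
    using gram_inner[of X v v] lv(3) by (simp add: power2_norm_eq_inner)
  then have "norm (X *v v) = sqrt (l * (norm v)\<^sup>2)"
    by (metis norm_ge_zero real_sqrt_unique)
  then show thesis using that lv by (simp add: real_sqrt_mult)
qed

text \<open>
  Maximum and minimum of the Rayleigh quotient are treated together: for \<open>c = 1\<close> the form
  \<open>c (\<parallel>X x\<parallel>\<^sup>2 - s\<^sup>2 \<parallel>x\<parallel>\<^sup>2)\<close> is nonnegative and vanishes at a minimiser, for \<open>c = - 1\<close> at a
  maximiser. In both cases the extremal vector is a null vector of a semidefinite form.
\<close>
lemma extremal_singular_value:
  fixes X :: "real^'n^'m"
  assumes "c \<noteq> 0"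
  shows "\<exists>s \<in> singular_values X. 0 \<le> s \<and> (\<forall>x. 0 \<le> c * ((norm (X *v x))\<^sup>2 - s\<^sup>2 * (norm x)\<^sup>2))"
proof -
  have "continuous_on (sphere 0 1) (\<lambda>x. c * (norm (X *v x))\<^sup>2)"
    by (intro continuous_intros linear_continuous_on_compose[OF continuous_on_id]) auto
  then have "\<exists>v\<in>sphere 0 1. \<forall>y\<in>sphere 0 1. c * (norm (X *v v))\<^sup>2 \<le> c * (norm (X *v y))\<^sup>2"
    by (rule continuous_attains_inf[OF compact_sphere, rotated]) simp
  then obtain v where v: "norm v = 1"
    and min: "\<And>y. norm y = 1 \<Longrightarrow> c * (norm (X *v v))\<^sup>2 \<le> c * (norm (X *v y))\<^sup>2"
    unfolding mem_sphere_0 Ball_def Bex_def by blast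
  define s where "s = norm (X *v v)"
  have form: "0 \<le> c * ((norm (X *v x))\<^sup>2 - s\<^sup>2 * (norm x)\<^sup>2)" for x
  proof (cases "x = 0")
    case False
    have "X *v (inverse (norm x) *\<^sub>R x) = inverse (norm x) *\<^sub>R (X *v x)"
      by (rule matrix_vector_mult_scaleR)
    then have "c * s\<^sup>2 \<le> c * (norm (X *v x) / norm x)\<^sup>2"
      using min[of "inverse (norm x) *\<^sub>R x"] False by (simp add: s_def divide_inverse mult.commute)
    then show ?thesis
      using False by (simp add: power_divide field_simps)
  qed simp
  define f where "f x = c *\<^sub>R ((transpose X ** X) *v x - s\<^sup>2 *\<^sub>R x)" for x
  have inner_f: "f x \<bullet> y = c * ((X *v x) \<bullet> (X *v y) - s\<^sup>2 * (x \<bullet> y))" for x y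
    by (simp add: f_def inner_diff_left gram_inner)
  have "(transpose X ** X) *v v = s\<^sup>2 *\<^sub>R v"
  proof -
    have "f v = 0"
    proof (rule semidefinite_null_vector[where f = f and v = v])
      show "linear f"
        unfolding f_def
        by (rule linearI) (simp_all add: matrix_vector_right_distrib matrix_vector_mult_scaleR
            algebra_simps)
      show "f x \<bullet> y = x \<bullet> f y" for x y
        using inner_f[of x y] inner_f[of y x] by (simp add: inner_commute)
      show "0 \<le> x \<bullet> f x" for x
        using form[of x] inner_f[of x x] by (simp add: inner_commute power2_norm_eq_inner)
      show "v \<bullet> f v = 0"
        using inner_f[of v v] v by (simp add: inner_commute s_def flip: power2_norm_eq_inner)
    qed
    with assms show ?thesis by (simp add: f_def)
  qed
  moreover have "v \<noteq> 0" using v by auto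
  ultimately have "sqrt (s\<^sup>2) \<in> singular_values X"
    unfolding singular_values_altdef by (intro imageI CollectI exI[of _ v] conjI)
  moreover have "0 \<le> s" by (simp add: s_def)
  ultimately have "s \<in> singular_values X" by simp
  with \<open>0 \<le> s\<close> form show ?thesis by (intro bexI[of _ s] conjI allI)
qed

lemma sigma_min_in: "sigma_min X \<in> singular_values X"
  unfolding sigma_min_def
  using extremal_singular_value[of 1 X] by (intro Min_in finite_singular_values) auto

lemma sigma_max_in: "sigma_max X \<in> singular_values X"
  unfolding sigma_max_def
  using extremal_singular_value[of 1 X] by (intro Max_in finite_singular_values) auto

lemma sigma_min_bound: "sigma_min X * norm x \<le> norm (X *v x)"
proof -
  obtain s where s: "s \<in> singular_values X" "0 \<le> s" "s\<^sup>2 * (norm x)\<^sup>2 \<le> (norm (X *v x))\<^sup>2"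
    using extremal_singular_value[of 1 X] by auto
  have "sigma_min X \<le> s"
    unfolding sigma_min_def using s(1) by (intro Min_le finite_singular_values)
  then have "sigma_min X * norm x \<le> s * norm x" by (simp add: mult_right_mono)
  also have "\<dots> \<le> norm (X *v x)"
    by (rule power2_le_imp_le) (use s(3) in \<open>simp_all add: power_mult_distrib\<close>)
  finally show ?thesis .
qed

lemma sigma_max_bound: "norm (X *v x) \<le> sigma_max X * norm x"
proof -
  obtain s where s: "s \<in> singular_values X" "0 \<le> s" "(norm (X *v x))\<^sup>2 \<le> s\<^sup>2 * (norm x)\<^sup>2"
    using extremal_singular_value[of "-1" X] by auto
  have "norm (X *v x) \<le> s * norm x"
    by (rule power2_le_imp_le) (use s(2,3) in \<open>simp_all add: power_mult_distrib\<close>)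
  also have "s \<le> sigma_max X"
    unfolding sigma_max_def using s(1) by (intro Max_ge finite_singular_values)
  then have "s * norm x \<le> sigma_max X * norm x" by (simp add: mult_right_mono)
  finally show ?thesis .
qed

lemma sigma_min_pos:
  fixes X :: "real^'n^'m"
  assumes "rank X = CARD('n)"
  shows "0 < sigma_min X"
proof -
  obtain v where v: "v \<noteq> 0" "norm (X *v v) = sigma_min X * norm v"
    using sigma_min_in by (rule singular_valueE)
  have "inj ((*v) X)" using assms by (simp add: full_rank_injective)
  then have "X *v v \<noteq> 0"
    using v(1) injD[of "(*v) X" v 0] by auto
  then have "0 < sigma_min X * norm v" by (simp flip: v(2))
  then show ?thesis by (simp add: zero_less_mult_iff)
qed

lemma kappa2_le:
  fixes X :: "real^'n^'m"
  assumes "0 < a" and lower: "\<And>x. a * norm x \<le> norm (X *v x)"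
    and upper: "\<And>x. norm (X *v x) \<le> b * norm x"
  shows "kappa2 X \<le> b / a"
proof -
  have "s \<in> {a..b}" if s: "s \<in> singular_values X" for s
  proof -
    obtain v where "v \<noteq> 0" "norm (X *v v) = s * norm v"
      using s by (rule singular_valueE)
    then show ?thesis using lower[of v] upper[of v] by simp
  qed
  from this[OF sigma_min_in] this[OF sigma_max_in] show ?thesis
    unfolding kappa2_def using \<open>0 < a\<close> by (intro frac_le) auto
qed

section \<open>Norms\<close>

lemma norm_le_spectral_norm: "norm (X *v x) \<le> spectral_norm X * norm x"
  unfolding spectral_norm_def by (rule onorm) simp

lemma spectral_norm_nonneg: "0 \<le> spectral_norm X"
  unfolding spectral_norm_def by (rule onorm_pos_le) simp

lemma spectral_norm_le_sigma_max: "spectral_norm X \<le> sigma_max X"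
  unfolding spectral_norm_def by (rule onorm_le) (rule sigma_max_bound)

lemma norm_isometry:
  fixes U :: "real^'n^'m"
  assumes "transpose U ** U = mat 1"
  shows "norm (U *v x) = norm x"
  using gram_inner[of U x x] assms by (simp add: norm_eq_sqrt_inner)

lemma norm_le_mult_componentwise:
  fixes x y :: "real^'n"
  assumes "0 \<le> b" and "\<And>i. \<bar>x $ i\<bar> \<le> b * \<bar>y $ i\<bar>"
  shows "norm x \<le> b * norm y"
  using norm_le_componentwise_cart[of x "b *\<^sub>R y"] assms by (simp add: abs_mult)

lemma diagonal_matrix_vector_nth:
  fixes S :: "real^'n^'n"
  assumes "\<forall>i j. i \<noteq> j \<longrightarrow> S $ i $ j = 0"
  shows "(S *v x) $ i = S $ i $ i * x $ i"
proof -
  have "(S *v x) $ i = (\<Sum>j\<in>UNIV. if j = i then S $ i $ i * x $ i else 0)"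
    unfolding matrix_vector_mult_def vec_lambda_beta
    by (rule sum.cong) (simp_all add: assms)
  then show ?thesis by simp
qed

section \<open>Perturbations of matrices with orthogonal columns\<close>

text \<open>
  The error is measured against a lower bound \<open>g\<close> for the column norms of \<open>B = U S + E\<close>, because
  scaling the columns of \<open>B\<close> to unit length magnifies it by at most \<open>1 / g\<close>. The same bound applied
  to the coordinate vectors compares the column norms \<open>S $ i $ i\<close> of \<open>U S\<close> with those of \<open>B\<close>.
\<close>
lemma kappa2D_perturbed_orthogonal_columns:
  fixes U E :: "real^'n^'m" and S :: "real^'n^'n"
  defines "B \<equiv> U ** S + E"
  assumes U: "transpose U ** U = mat 1"
    and S: "\<forall>i j. i \<noteq> j \<longrightarrow> S $ i $ j = 0" "\<forall>i. 0 \<le> S $ i $ i"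
    and col: "\<And>i. 0 < g \<and> g \<le> norm (column i B)"
    and E: "\<And>x. norm (E *v x) \<le> \<delta> * g * norm x"
    and \<delta>: "0 \<le> \<delta>" "\<delta> < 1/2"
  shows "kappa2D B \<le> (1 + 2 * \<delta>) / (1 - 2 * \<delta>)"
proof -
  define D where "D = column_scaling B"
  have D: "(D *v x) $ i = x $ i / norm (column i B)" for x i
    by (subst diagonal_matrix_vector_nth) (auto simp: D_def column_scaling_def divide_inverse)
  have split: "B *v x = U *v (S *v x) + E *v x" for x
    by (simp add: B_def matrix_vector_mult_add_rdistrib matrix_vector_mul_assoc)
  have g: "0 < g" using col by blast
  have "\<bar>norm (column i B) - S $ i $ i\<bar> \<le> \<delta> * g" for i
  proof -
    have "S *v axis i 1 = S $ i $ i *\<^sub>R axis i 1"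
      by (simp add: vec_eq_iff diagonal_matrix_vector_nth[OF S(1)] axis_def)
    then have "norm (U *v (S *v axis i 1)) = S $ i $ i"
      using S(2) by (simp add: norm_isometry[OF U])
    moreover have "column i B = U *v (S *v axis i 1) + E *v axis i 1"
      using split[of "axis i 1"] by (simp add: matrix_vector_mult_basis)
    ultimately show ?thesis
      using E[of "axis i 1"] norm_triangle_ineq3[of "column i B" "U *v (S *v axis i 1)"] by simp
  qed
  moreover have "\<delta> * g \<le> \<delta> * norm (column i B)" for i
    using col \<delta> by (simp add: mult_left_mono)
  ultimately have close: "\<bar>norm (column i B) - S $ i $ i\<bar> \<le> \<delta> * norm (column i B)" for i
    using order_trans by blast
  have main: "(1 - \<delta>) * norm x \<le> norm (S *v (D *v x))" "norm (S *v (D *v x)) \<le> (1 + \<delta>) * norm x"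
    for x
  proof -
    define r where "r i = S $ i $ i / norm (column i B)" for i
    have "0 < norm (column i B)" for i using col[of i] by linarith
    then have r: "1 - \<delta> \<le> r i" "r i \<le> 1 + \<delta>" for i
      using close[of i] by (simp_all add: r_def field_simps abs_le_iff)
    then have r0: "0 < r i" for i using \<delta> r(1)[of i] by linarith
    have SD: "(S *v (D *v x)) $ i = r i * x $ i" for i
      by (simp add: diagonal_matrix_vector_nth[OF S(1)] D r_def)
    have SD_abs: "\<bar>(S *v (D *v x)) $ i\<bar> = r i * \<bar>x $ i\<bar>" for i
      unfolding SD abs_mult abs_of_pos[OF r0] ..
    show "norm (S *v (D *v x)) \<le> (1 + \<delta>) * norm x"
    proof (rule norm_le_mult_componentwise)
      show "0 \<le> 1 + \<delta>" using \<delta> by linarith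
      show "\<bar>(S *v (D *v x)) $ i\<bar> \<le> (1 + \<delta>) * \<bar>x $ i\<bar>" for i
        unfolding SD_abs by (rule mult_right_mono[OF r(2) abs_ge_zero])
    qed
    have "norm ((1 - \<delta>) *\<^sub>R x) \<le> norm (S *v (D *v x))"
    proof (rule norm_le_componentwise_cart)
      have "\<bar>1 - \<delta>\<bar> = 1 - \<delta>" using \<delta> by linarith
      then show "norm (((1 - \<delta>) *\<^sub>R x) $ i) \<le> norm ((S *v (D *v x)) $ i)" for i
        unfolding vector_scaleR_component real_norm_def real_scaleR_def abs_mult[of "1 - \<delta>"] SD_abs
        using mult_right_mono[OF r(1) abs_ge_zero] by metis
    qed
    then show "(1 - \<delta>) * norm x \<le> norm (S *v (D *v x))" using \<delta> by simp
  qed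
  have "norm (D *v x) \<le> 1 / g * norm x" for x
  proof (rule norm_le_mult_componentwise)
    show "\<bar>(D *v x) $ i\<bar> \<le> 1 / g * \<bar>x $ i\<bar>" for i
      using g col[of i] by (auto simp: D abs_divide intro!: divide_left_mono mult_pos_pos)
  qed (use g in simp)
  then have err: "norm (E *v (D *v x)) \<le> \<delta> * norm x" for x
  proof -
    have "norm (E *v (D *v x)) \<le> \<delta> * g * norm (D *v x)" by (rule E)
    also have "\<dots> \<le> \<delta> * g * (1 / g * norm x)"
      using \<delta> g \<open>norm (D *v x) \<le> 1 / g * norm x\<close> by (intro mult_left_mono) auto
    finally show ?thesis using g by simp
  qed
  have BD: "(B ** D) *v x = U *v (S *v (D *v x)) + E *v (D *v x)" for x
    by (simp add: split flip: matrix_vector_mul_assoc)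
  show ?thesis
    unfolding kappa2D_def D_def[symmetric]
  proof (rule kappa2_le)
    fix x
    have US: "norm (U *v (S *v (D *v x))) = norm (S *v (D *v x))" by (rule norm_isometry[OF U])
    have "norm (S *v (D *v x)) - norm (E *v (D *v x)) \<le> norm ((B ** D) *v x)"
      unfolding BD US[symmetric] by (rule norm_diff_ineq)
    with main(1)[of x] err[of x] show "(1 - 2 * \<delta>) * norm x \<le> norm ((B ** D) *v x)"
      by (simp add: left_diff_distrib)
    have "norm ((B ** D) *v x) \<le> norm (S *v (D *v x)) + norm (E *v (D *v x))"
      unfolding BD US[symmetric] by (rule norm_triangle_ineq)
    with main(2)[of x] err[of x] show "norm ((B ** D) *v x) \<le> (1 + 2 * \<delta>) * norm x"
      by (simp add: distrib_right)
  qed (use \<delta> in simp)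
qed

section \<open>The preconditioned matrix\<close>

theorem proposition3p7:
  fixes A \<Delta>A U\<^sub>l :: "real^'n^'m"
    and \<Sigma>\<^sub>l V \<Delta>V :: "real^'n^'n"
    and u u\<^sub>l p\<^sub>1 p\<^sub>6 :: real
  assumes "CARD('n) \<le> CARD('m)"
    and "rank A = CARD('n)"
    and "0 < u" and "u < u\<^sub>l"
    and "spectral_norm (transpose V ** V - mat 1) \<le> p\<^sub>1 * u" and "p\<^sub>1 * u < 1"
    and "A + \<Delta>A = U\<^sub>l ** \<Sigma>\<^sub>l ** transpose (V + \<Delta>V)"
    and "spectral_norm \<Delta>A \<le> p\<^sub>6 * u\<^sub>l * spectral_norm A"
    and "spectral_norm \<Delta>V \<le> p\<^sub>6 * u"
    and "transpose U\<^sub>l ** U\<^sub>l = mat 1"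
    and "\<forall>i j. i \<noteq> j \<longrightarrow> \<Sigma>\<^sub>l $ i $ j = 0" and "\<forall>i. 0 \<le> \<Sigma>\<^sub>l $ i $ i"
    and "orthogonal_matrix (V + \<Delta>V)"
    and "p\<^sub>1 \<le> p\<^sub>6"
    and "5 * p\<^sub>6 * (u\<^sub>l + u) * kappa2 A \<le> 1"
  shows "kappa2D (A ** V) \<le> 3"
proof -
  define W where "W = V + \<Delta>V"
  define \<sigma> where "\<sigma> = sigma_min A"
  define a where "a = p\<^sub>6 * u * spectral_norm A"
  define b where "b = p\<^sub>6 * u\<^sub>l * spectral_norm A"
  have W: "transpose W ** W = mat 1"
    using assms(13) by (simp add: W_def orthogonal_matrix)
  have \<sigma>: "0 < \<sigma>" using sigma_min_pos[OF assms(2)] by (simp add: \<sigma>_def)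
  have "0 \<le> p\<^sub>6 * u" using spectral_norm_nonneg[of \<Delta>V] assms(9) by linarith
  then have p6: "0 \<le> p\<^sub>6" using assms(3) by (simp add: zero_le_mult_iff)
  have a: "0 \<le> a" and b: "0 \<le> b"
    using p6 assms(3,4) spectral_norm_nonneg[of A] by (simp_all add: a_def b_def)
  have small: "5 * (a + b) \<le> \<sigma>"
  proof -
    have "5 * (a + b) = 5 * p\<^sub>6 * (u\<^sub>l + u) * spectral_norm A"
      by (simp add: a_def b_def algebra_simps)
    also have "\<dots> \<le> 5 * p\<^sub>6 * (u\<^sub>l + u) * sigma_max A"
      using p6 assms(3,4) by (intro mult_left_mono spectral_norm_le_sigma_max) auto
    also have "\<dots> \<le> \<sigma>"
      using assms(15) \<sigma> by (simp add: kappa2_def \<sigma>_def field_simps)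
    finally show ?thesis .
  qed

  define E where "E = A ** V - U\<^sub>l ** \<Sigma>\<^sub>l"
  have AdV: "norm (A *v (\<Delta>V *v x)) \<le> a * norm x" for x
  proof -
    have "norm (A *v (\<Delta>V *v x)) \<le> spectral_norm A * (spectral_norm \<Delta>V * norm x)"
      by (rule order_trans[OF norm_le_spectral_norm])
        (intro mult_left_mono norm_le_spectral_norm spectral_norm_nonneg)
    also have "\<dots> \<le> spectral_norm A * (p\<^sub>6 * u * norm x)"
      by (intro mult_left_mono mult_right_mono assms(9) spectral_norm_nonneg norm_ge_zero)
    finally show ?thesis by (simp add: a_def mult_ac)
  qed
  have dAW: "norm (\<Delta>A *v (W *v x)) \<le> b * norm x" for x
  proof -
    have "norm (\<Delta>A *v (W *v x)) \<le> spectral_norm \<Delta>A * norm x"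
      using norm_le_spectral_norm[of \<Delta>A "W *v x"] by (simp add: norm_isometry[OF W])
    also have "\<dots> \<le> b * norm x"
      unfolding b_def by (intro mult_right_mono assms(8) norm_ge_zero)
    finally show ?thesis .
  qed
  have AV: "(A ** V) *v x = A *v (W *v x) - A *v (\<Delta>V *v x)" for x
    by (simp add: W_def matrix_vector_mult_add_rdistrib matrix_vector_right_distrib
        flip: matrix_vector_mul_assoc)
  have "(A + \<Delta>A) ** W = U\<^sub>l ** \<Sigma>\<^sub>l"
    using assms(7) W by (simp add: W_def flip: matrix_mul_assoc)
  then have US: "(U\<^sub>l ** \<Sigma>\<^sub>l) *v x = A *v (W *v x) + \<Delta>A *v (W *v x)" for x
    by (metis matrix_vector_mul_assoc matrix_vector_mult_add_rdistrib)
  have E: "norm (E *v x) \<le> (a + b) * norm x" for x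
  proof -
    have "E *v x = - (A *v (\<Delta>V *v x)) - \<Delta>A *v (W *v x)"
      by (simp add: E_def matrix_vector_mult_diff_rdistrib AV US)
    then have "norm (E *v x) \<le> norm (A *v (\<Delta>V *v x)) + norm (\<Delta>A *v (W *v x))"
      using norm_triangle_ineq4[of "- (A *v (\<Delta>V *v x))" "\<Delta>A *v (W *v x)"] by (simp only: norm_minus_cancel)
    then show ?thesis
      using AdV[of x] dAW[of x] by (simp add: distrib_right)
  qed
  have col: "4/5 * \<sigma> \<le> norm (column i (A ** V))" for i
  proof -
    let ?e = "axis i (1::real) :: real^'n"
    have "\<sigma> \<le> norm (A *v (W *v ?e))"
      using sigma_min_bound[of A "W *v ?e"] by (simp add: \<sigma>_def norm_isometry[OF W])
    moreover have "norm (A *v (\<Delta>V *v ?e)) \<le> \<sigma> / 5"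
      using AdV[of ?e] small b by simp
    ultimately have "4/5 * \<sigma> \<le> norm ((A ** V) *v ?e)"
      using norm_triangle_ineq2[of "A *v (W *v ?e)" "A *v (\<Delta>V *v ?e)"] by (simp add: AV)
    then show ?thesis by (simp add: matrix_vector_mult_basis)
  qed
  have "kappa2D (U\<^sub>l ** \<Sigma>\<^sub>l + E) \<le> (1 + 2 * (1/4)) / (1 - 2 * (1/4))"
  proof (rule kappa2D_perturbed_orthogonal_columns[where g = "4/5 * \<sigma>"])
    show "0 < 4/5 * \<sigma> \<and> 4/5 * \<sigma> \<le> norm (column i (U\<^sub>l ** \<Sigma>\<^sub>l + E))" for i
      using \<sigma> col by (simp add: E_def)
    have "a + b \<le> 1/4 * (4/5 * \<sigma>)" using small by simp
    then show "norm (E *v x) \<le> 1/4 * (4/5 * \<sigma>) * norm x" for x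
      by (rule order_trans[OF E mult_right_mono[OF _ norm_ge_zero]])
  qed (simp_all add: assms(10-12))
  then show ?thesis by (simp add: E_def)
qed

end
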